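(* Let $p\ge 2$ be an integer, let $s>p-2$, and let $A\subset\mathbb R^p$ be a nonempty compact set. There exist constants $\kappa_{s,p},c_{s,p}>0$ depending only on $p$ and $s$ (in particular not on $A$) such that for every $\epsilon>0$ and every $N\in\mathbb N$: if $\mathcal P_s^*(A,N)<+\infty$ and $\omega_N^*=\{x_1,\ldots,x_N\}\subset\mathbb R^p$ is an $N$-point multiset satisfying $$P_s(A,\omega_N^* )=\mathcal P_s^*(A,N),$$ then $$\#\left(\omega_N^*\setminus A_\epsilon\right)\le \kappa_{s,p}\,\frac{\mathcal L_p\left(\left(\operatorname{conv}(A)\right)_{\epsilon c_{s,p}}\right)}{\epsilon^p}.$$
   Context: Configurations are $N$-point multisets (points may be repeated) and $\#$ denotes cardinality of a multiset counted with repetitions. For $s>0$, $K_s(x,y):=|x-y|^{-s}$ with $K_s(x,x)=+\infty$. For nonempty $A\subset\mathbb R^p$, $$P_s(A,\omega_N):=\inf_{y\in A}\sum_{i=1}^N K_s(x_i,y),\qquad \mathcal P_s^*(A,N):=\sup_{\omega_N\subset\mathbb R^p}P_s(A,\omega_N),$$ the supremum being over $N$-point multisets in $\mathbb R^p$. For a set $S\subset\mathbb R^p$ and $r>0$, $S_r:=\{x\in\mathbb R^p:\operatorname{dist}(x,S)<r\}$. $\operatorname{conv}(A)$ is the convex hull of $A$ and $\mathcal L_p$ is $p$-dimensional Lebesgue measure. *)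

theory Defs
  imports "HOL-Analysis.Analysis" "HOL-Library.Multiset"
begin

text \<open>The kernel takes the value \<open>\<infinity>\<close> on the diagonal, so potentials and polarization
  values live in \<^typ>\<open>ennreal\<close>.  All notions are meant for \<open>s > 0\<close>.\<close>

definition riesz_kernel :: "real \<Rightarrow> 'a::euclidean_space \<Rightarrow> 'a \<Rightarrow> ennreal" where
  "riesz_kernel s x y = (if x = y then \<infinity> else ennreal (norm (x - y) powr (- s)))"

definition polarization :: "real \<Rightarrow> 'a::euclidean_space set \<Rightarrow> 'a multiset \<Rightarrow> ennreal" where
  "polarization s A \<omega> = (INF y\<in>A. \<Sum>x\<in>#\<omega>. riesz_kernel s x y)"

text \<open>The supremum ranges over configurations in the whole space, not only in \<open>A\<close>.\<close>

definition max_polarization :: "real \<Rightarrow> 'a::euclidean_space set \<Rightarrow> nat \<Rightarrow> ennreal" where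
  "max_polarization s A N = (SUP \<omega>\<in>{\<omega>. size \<omega> = N}. polarization s A \<omega>)"

text \<open>Used for nonempty \<open>S\<close> only: \<^term>\<open>infdist x {}\<close> is \<open>0\<close> by convention.\<close>

definition open_nbhd :: "'a::euclidean_space set \<Rightarrow> real \<Rightarrow> 'a set" where
  "open_nbhd S r = {x. infdist x S < r}"

end

theory Submission
  imports Defs
begin

text \<open>For \<open>s > p - 2\<close> the kernel is strictly subharmonic off the diagonal. Hence, if \<open>2 p\<close> points at
  distance at least \<open>\<epsilon>\<close> from \<open>A\<close> lay in a ball of radius \<open>\<rho> \<epsilon>\<close>, with \<open>\<rho>\<close> small depending on \<open>s\<close> and
  \<open>p\<close> only, displacing them by \<open>\<plusminus>h e\<^sub>k\<close> with \<open>h\<close> a small multiple of \<open>\<epsilon>\<close> would raise the potential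
  uniformly on \<open>A\<close>, against optimality. Optimality also places all points in the convex hull of
  \<open>A\<close>, since projecting a point onto it brings the point closer to all of \<open>A\<close>. A volume packing
  argument then bounds the number of points far from \<open>A\<close>.\<close>

section \<open>Taylor expansion of a negative power\<close>

text \<open>Lagrange's remainder of order three: for \<open>\<bar>t\<bar> \<le> 1/2\<close> the base
  \<open>1 + t\<close> is at least \<open>1/2\<close>, so the third derivative is bounded by a
  constant depending on \<open>a\<close> only.\<close>

lemma powr_minus_taylor2:
  fixes a :: real
  assumes "a > 0"
  shows "\<exists>C\<ge>0. \<forall>q. \<bar>q\<bar> \<le> 1/2 \<longrightarrow>
    \<bar>(1 + q) powr (- a) - (1 - a * q + a * (a + 1) / 2 * q\<^sup>2)\<bar> \<le> C * \<bar>q\<bar> ^ 3"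
proof -
  \<comment> \<open>\<open>D m\<close> is the \<open>m\<close>-th derivative of
    \<open>(1 + t) powr (- a)\<close>; \<open>C\<close> is
    \<open>\<bar>D 3 (-1/2)\<bar> / 6\<close>, the worst case of the remainder.\<close>
  define D :: "nat \<Rightarrow> real \<Rightarrow> real"
    where "D m t = (-1) ^ m * pochhammer a m * (1 + t) powr (- a - real m)" for m t
  define C where "C = pochhammer a 3 * (1/2) powr (- a - 3) / 6"
  have "\<bar>(1 + q) powr (- a) - (1 - a * q + a * (a + 1) / 2 * q\<^sup>2)\<bar> \<le> C * \<bar>q\<bar> ^ 3"
    if q: "\<bar>q\<bar> \<le> 1/2" for q
  \<comment> \<open>Taylor's formula requires a point other than the centre of expansion.\<close>
  proof (cases "q = 0")
    case False
    have "\<exists>t. (if q < 0 then q < t \<and> t < 0 else 0 < t \<and> t < q) \<and>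
      (1 + q) powr (- a) = (\<Sum>m<3. D m 0 / fact m * (q - 0) ^ m) + D 3 t / fact 3 * (q - 0) ^ 3"
    proof (rule Taylor[where a = "-1/2" and b = "1/2"])
      show "\<forall>m t. m < 3 \<and> -1/2 \<le> t \<and> t \<le> 1/2 \<longrightarrow> DERIV (D m) t :> D (Suc m) t"
      proof (intro allI impI, elim conjE)
        fix m :: nat and t :: real assume "-1/2 \<le> t"
        then show "DERIV (D m) t :> D (Suc m) t"
          unfolding D_def
          by (auto intro!: derivative_eq_intros simp: pochhammer_Suc algebra_simps)
      qed
    qed (use q False in \<open>auto simp: D_def fun_eq_iff\<close>)
    then obtain t where "if q < 0 then q < t \<and> t < 0 else 0 < t \<and> t < q"
      and eq: "(1 + q) powr (- a) = (\<Sum>m<3. D m 0 / fact m * q ^ m) + D 3 t / fact 3 * q ^ 3"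
      unfolding diff_0_right by blast
    then have t: "\<bar>t\<bar> \<le> 1/2" using q by (auto split: if_splits)
    have "(\<Sum>m<3. D m 0 / fact m * q ^ m) = 1 - a * q + a * (a + 1) / 2 * q\<^sup>2"
      by (simp add: D_def eval_nat_numeral pochhammer_Suc)
    then have "\<bar>(1 + q) powr (- a) - (1 - a * q + a * (a + 1) / 2 * q\<^sup>2)\<bar>
        = \<bar>D 3 t\<bar> / 6 * \<bar>q\<bar> ^ 3"
      unfolding eq by (simp add: abs_mult power_abs fact_numeral)
    also have "\<dots> \<le> C * \<bar>q\<bar> ^ 3"
    proof (rule mult_right_mono)
      have "(1 + t) powr (- a - 3) \<le> (1/2) powr (- a - 3)"
        using t assms by (intro powr_mono2') auto
      moreover have "pochhammer a 3 \<ge> 0" using assms by (intro pochhammer_nonneg) auto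
      ultimately show "\<bar>D 3 t\<bar> / 6 \<le> C"
        by (simp add: D_def C_def abs_mult mult_left_mono)
    qed auto
    finally show ?thesis .
  qed simp
  moreover have "C \<ge> 0"
    using assms by (simp add: C_def pochhammer_nonneg)
  ultimately show ?thesis by blast
qed

section \<open>Consequences of optimality\<close>

text \<open>Exchanging \<open>M\<close> for \<open>M'\<close> raises the potential by
  \<open>\<gamma>\<close> on all of \<open>A\<close>. The gain has to be uniform to survive the
  infimum, and the optimal value finite, since adding \<open>\<gamma>\<close> to
  \<open>\<infinity>\<close> changes nothing.\<close>

lemma optimal_no_gain:
  fixes A :: "'a::euclidean_space set"
  assumes opt: "polarization s A \<omega> = max_polarization s A (size \<omega>)"
    and fin: "max_polarization s A (size \<omega>) < \<infinity>"
    and M: "M \<subseteq># \<omega>" "size M' = size M"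
    and gain: "\<gamma> > 0" "\<And>y. y \<in> A \<Longrightarrow>
      (\<Sum>x\<in>#M. riesz_kernel s x y) + ennreal \<gamma> \<le> (\<Sum>x\<in>#M'. riesz_kernel s x y)"
  shows False
proof -
  define \<omega>' where "\<omega>' = \<omega> - M + M'"
  have \<omega>: "\<omega> = \<omega> - M + M" using M by simp
  have "size \<omega>' = size \<omega>"
    unfolding \<omega>'_def size_union M(2) by (metis \<omega> size_union)
  then have le: "polarization s A \<omega>' \<le> max_polarization s A (size \<omega>)"
    unfolding max_polarization_def by (intro SUP_upper) simp
  have "polarization s A \<omega> + ennreal \<gamma> \<le> polarization s A \<omega>'"
    unfolding polarization_def
  proof (rule INF_greatest)
    fix y assume y: "y \<in> A"
    have "(INF y\<in>A. \<Sum>x\<in>#\<omega>. riesz_kernel s x y) + ennreal \<gamma>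
        \<le> (\<Sum>x\<in>#\<omega>. riesz_kernel s x y) + ennreal \<gamma>"
      using y by (intro add_right_mono INF_lower)
    also have "\<dots> = (\<Sum>x\<in>#\<omega> - M. riesz_kernel s x y)
        + ((\<Sum>x\<in>#M. riesz_kernel s x y) + ennreal \<gamma>)"
      by (subst \<omega>) (simp only: image_mset_union sum_mset.union add.assoc)
    also have "\<dots> \<le> (\<Sum>x\<in>#\<omega>'. riesz_kernel s x y)"
      using gain(2)[OF y] by (simp add: \<omega>'_def add_left_mono)
    finally show "(INF y\<in>A. \<Sum>x\<in>#\<omega>. riesz_kernel s x y) + ennreal \<gamma>
        \<le> (\<Sum>x\<in>#\<omega>'. riesz_kernel s x y)" .
  qed
  then have "polarization s A \<omega> + ennreal \<gamma> \<le> polarization s A \<omega>"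
    using le opt by (metis order_trans)
  moreover have "polarization s A \<omega> < \<infinity>" using opt fin by simp
  ultimately show False
    using gain(1) by (cases "polarization s A \<omega>") (auto simp: ennreal_plus[symmetric] simp del: ennreal_plus)
qed

text \<open>The angle at the projection \<open>p\<close> between \<open>x\<close> and any point
  \<open>y\<close> of \<open>A\<close> is at least a right angle, so the squared distance to
  \<open>y\<close> drops by at least \<open>d\<close> squared. Boundedness of \<open>A\<close> turns
  this into a fixed contraction factor \<open>k\<close>, hence into a uniform gain.\<close>

lemma optimal_in_convex_hull:
  fixes A :: "'a::euclidean_space set"
  assumes "s > 0" "A \<noteq> {}" "compact A"
    and opt: "polarization s A \<omega> = max_polarization s A (size \<omega>)"
    and fin: "max_polarization s A (size \<omega>) < \<infinity>"
    and x: "x \<in># \<omega>"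
  shows "x \<in> convex hull A"
proof (rule ccontr)
  assume nin: "x \<notin> convex hull A"
  let ?C = "convex hull A"
  define p where "p = closest_point ?C x"
  have C: "closed ?C" "convex ?C" "?C \<noteq> {}"
    using assms by (auto intro: compact_imp_closed compact_convex_hull)
  have AC: "A \<subseteq> ?C" by (rule hull_subset)
  have pC: "p \<in> ?C" unfolding p_def using C by (intro closest_point_in_set)
  define d where "d = norm (x - p)"
  have d: "d > 0" using nin pC by (auto simp: d_def)
  obtain B0 where B0: "\<And>y. y \<in> A \<Longrightarrow> norm (x - y) \<le> B0"
    using compact_imp_bounded[OF \<open>compact A\<close>] bounded_any_center[of A x]
    by (auto simp: dist_norm)
  \<comment> \<open>The maximum with \<open>2 * d\<close> forces \<open>d < B\<close>, so that
    \<open>k\<close> below is positive.\<close>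
  define B where "B = max B0 (2 * d)"
  have B: "\<And>y. y \<in> A \<Longrightarrow> norm (x - y) \<le> B" and Bd: "B \<ge> 2 * d"
    using B0 by (force simp: B_def)+
  have Bpos: "B > 0" using d Bd by simp
  have dB: "d\<^sup>2 < B\<^sup>2" using d Bd by (intro power_strict_mono) auto
  define k where "k = sqrt (1 - d\<^sup>2 / B\<^sup>2)"
  have k: "0 < k" "k < 1" "k\<^sup>2 = 1 - d\<^sup>2 / B\<^sup>2"
    using d dB Bd Bpos by (auto simp: k_def power_mono)
  have k1: "k powr (- s) > 1" using k \<open>s > 0\<close> using powr_less_mono2_neg[of "- s" k 1] by simp
  \<comment> \<open>The gain at \<open>y\<close> is at least \<open>k powr (- s) - 1\<close> times
    the old kernel value, which is smallest at the largest distance \<open>B\<close>.\<close>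
  define \<gamma> where "\<gamma> = (k powr (- s) - 1) * B powr (- s)"
  show False
  proof (rule optimal_no_gain[OF opt fin, where M = "{#x#}" and M' = "{#p#}"])
    show "\<gamma> > 0" using k1 Bpos by (simp add: \<gamma>_def)
    fix y assume y: "y \<in> A"
    have xy: "x \<noteq> y" using y nin AC by auto
    show "(\<Sum>x\<in>#{#x#}. riesz_kernel s x y) + ennreal \<gamma> \<le> (\<Sum>x\<in>#{#p#}. riesz_kernel s x y)"
    \<comment> \<open>If \<open>p = y\<close>, the new kernel value is infinite and the inequality
      is trivial.\<close>
    proof (cases "p = y")
      case False
      have "(x - p) \<bullet> (y - p) \<le> 0"
        unfolding p_def using C AC y by (intro closest_point_dot) auto
      moreover have "(norm (x - y))\<^sup>2 = d\<^sup>2 + (norm (p - y))\<^sup>2 - 2 * ((x - p) \<bullet> (y - p))"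
        by (simp add: d_def power2_norm_eq_inner algebra_simps inner_commute)
      ultimately have "(norm (p - y))\<^sup>2 \<le> (norm (x - y))\<^sup>2 - d\<^sup>2" by simp
      also have "\<dots> \<le> (norm (x - y))\<^sup>2 - d\<^sup>2 * ((norm (x - y))\<^sup>2 / B\<^sup>2)"
        using B[OF y] Bpos by (simp add: power_mono divide_le_eq mult_left_mono)
      also have "\<dots> = (k * norm (x - y))\<^sup>2"
        by (simp add: power_mult_distrib k(3) algebra_simps)
      finally have le: "norm (p - y) \<le> k * norm (x - y)"
        by (rule power2_le_imp_le) (use k in simp)
      have "norm (x - y) powr (- s) + \<gamma>
          \<le> norm (x - y) powr (- s) + (k powr (- s) - 1) * norm (x - y) powr (- s)"
        unfolding \<gamma>_def using k1 xy B[OF y] \<open>s > 0\<close>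
        by (intro add_left_mono mult_left_mono powr_mono2') auto
      also have "\<dots> = (k * norm (x - y)) powr (- s)"
        using k by (simp add: powr_mult algebra_simps)
      also have "\<dots> \<le> norm (p - y) powr (- s)"
        using False \<open>s > 0\<close> le by (intro powr_mono2') auto
      finally show ?thesis
        using xy False \<open>\<gamma> > 0\<close>
        by (simp add: riesz_kernel_def ennreal_plus[symmetric] ennreal_leI del: ennreal_plus)
    qed (simp add: riesz_kernel_def)
  qed (use x in auto)
qed

section \<open>Separated subsets of sparse multisets\<close>

text \<open>Greedy selection: keep a point \<open>x\<close>, discard the at most \<open>k\<close>
  entries within distance \<open>r\<close> of it, and recurse on the rest. Repetitions count towards
  \<open>k\<close>, so the result is a genuine set.\<close>

lemma sparse_mset_separated_subset:
  fixes X :: "'a::metric_space multiset"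
  assumes "r \<ge> 0" and "\<And>x. x \<in># X \<Longrightarrow> size {#y \<in># X. dist x y \<le> r#} \<le> k"
  shows "\<exists>T. T \<subseteq> set_mset X \<and> pairwise (\<lambda>x y. dist x y > r) T \<and> size X \<le> k * card T"
  using assms(2)
proof (induction "size X" arbitrary: X rule: less_induct)
  case less
  show ?case
  proof (cases "X = {#}")
    case False
    then obtain x where x: "x \<in># X" by auto
    define N where "N = {#y \<in># X. dist x y \<le> r#}"
    define Y where "Y = {#y \<in># X. \<not> dist x y \<le> r#}"
    have X: "X = N + Y" unfolding N_def Y_def by (rule multiset_partition)
    show ?thesis
    proof -
      \<comment> \<open>\<open>x\<close> lies in its own neighbourhood, so at least one entry is
        discarded and the recursion terminates.\<close>
      have "x \<in># N" using x \<open>r \<ge> 0\<close> by (simp add: N_def)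
      then have "size Y < size X" by (subst X) (auto simp: nonempty_has_size[symmetric])
      moreover have "size {#z \<in># Y. dist y z \<le> r#} \<le> k" if "y \<in># Y" for y
      proof -
        have "size {#z \<in># Y. dist y z \<le> r#} \<le> size {#z \<in># X. dist y z \<le> r#}"
          by (intro size_mset_mono multiset_filter_mono) (simp add: X)
        also have "\<dots> \<le> k" using that less.prems by (simp add: Y_def)
        finally show ?thesis .
      qed
      ultimately obtain T where T: "T \<subseteq> set_mset Y" "pairwise (\<lambda>x y. dist x y > r) T"
        "size Y \<le> k * card T"
        using less.hyps by blast
      have "finite T" using T(1) by (rule finite_subset) simp
      moreover have "x \<notin> T" using T(1) \<open>r \<ge> 0\<close> by (auto simp: Y_def)
      moreover have "size N \<le> k" using less.prems x by (simp add: N_def)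
      ultimately have "size X \<le> k * card (insert x T)" using T(3) by (subst X) simp
      moreover have "insert x T \<subseteq> set_mset X" using T(1) x by (auto simp: Y_def)
      moreover have "pairwise (\<lambda>x y. dist x y > r) (insert x T)"
        using T(1,2) by (auto simp: pairwise_insert Y_def dist_commute not_le)
      ultimately show ?thesis by blast
    qed
  qed simp
qed

section \<open>Second-order effect of displacing points, and the size of clusters\<close>

text \<open>The squared norm of \<open>z + \<eta> *\<^sub>R u\<close> is \<open>1 + q\<close> with
  \<open>q\<close> of order \<open>\<eta>\<close>, so the one-variable expansion applies with
  exponent \<open>s/2\<close>. The constant is uniform in \<open>z\<close> and \<open>u\<close>;
  \<open>\<eta> \<le> 1/16\<close> ensures \<open>\<bar>q\<bar> \<le> 1/2\<close>.\<close>

lemma norm_powr_expansion: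
  fixes s :: real
  assumes "s > 0"
  shows "\<exists>C\<ge>0. \<forall>(z::'a::euclidean_space) u \<eta>.
    norm z = 1 \<longrightarrow> norm u \<le> 2 \<longrightarrow> 0 \<le> \<eta> \<longrightarrow> \<eta> \<le> 1/16 \<longrightarrow>
    \<bar>norm (z + \<eta> *\<^sub>R u) powr (- s)
      - (1 - s * \<eta> * (z \<bullet> u) + \<eta>\<^sup>2 / 2 * (s * (s + 2) * (z \<bullet> u)\<^sup>2 - s * (u \<bullet> u)))\<bar> \<le> C * \<eta> ^ 3"
proof -
  obtain C where C: "C \<ge> 0" "\<And>q. \<bar>q\<bar> \<le> 1/2 \<Longrightarrow>
    \<bar>(1 + q) powr (- (s/2)) - (1 - s/2 * q + s/2 * (s/2 + 1) / 2 * q\<^sup>2)\<bar> \<le> C * \<bar>q\<bar> ^ 3"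
    using powr_minus_taylor2[of "s/2"] assms by auto
  \<comment> \<open>The first summand absorbs the Taylor remainder through
    \<open>\<bar>q\<bar> \<le> 8 * \<eta>\<close>, the second the cubic error of replacing
    \<open>q\<^sup>2\<close> by its leading part
    \<open>4 * \<eta>\<^sup>2 * \<tau>\<^sup>2\<close>.\<close>
  define C' where "C' = C * 8 ^ 3 + s/2 * (s/2 + 1) / 2 * 48"
  have "\<bar>norm (z + \<eta> *\<^sub>R u) powr (- s)
      - (1 - s * \<eta> * (z \<bullet> u) + \<eta>\<^sup>2 / 2 * (s * (s + 2) * (z \<bullet> u)\<^sup>2 - s * (u \<bullet> u)))\<bar> \<le> C' * \<eta> ^ 3"
    (is "\<bar>_ - ?E\<bar> \<le> _")
    if z: "norm z = 1" and u: "norm u \<le> 2" and \<eta>: "0 \<le> \<eta>" "\<eta> \<le> 1/16" for z u :: 'a and \<eta>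
  proof -
    define \<tau> where "\<tau> = z \<bullet> u"
    define \<nu> where "\<nu> = u \<bullet> u"
    have \<tau>: "\<bar>\<tau>\<bar> \<le> 2" using Cauchy_Schwarz_ineq2[of z u] z u by (simp add: \<tau>_def)
    have \<nu>: "0 \<le> \<nu>" "\<nu> \<le> 4"
      using power_mono[OF u, of 2] by (simp_all add: \<nu>_def power2_norm_eq_inner)
    define q where "q = 2 * \<eta> * \<tau> + \<eta>\<^sup>2 * \<nu>"
    have zz: "z \<bullet> z = 1" using z by (simp add: norm_eq_1)
    have N2: "(norm (z + \<eta> *\<^sub>R u))\<^sup>2 = 1 + q"
      unfolding power2_norm_eq_inner q_def \<tau>_def \<nu>_def inner_add_left inner_add_right zz
      by (simp add: inner_commute power2_eq_square)
    have "\<bar>q\<bar> \<le> 2 * \<eta> * \<bar>\<tau>\<bar> + \<eta>\<^sup>2 * \<nu>"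
      unfolding q_def using \<eta> \<nu> by (intro order_trans[OF abs_triangle_ineq]) (simp add: abs_mult)
    also have "\<dots> \<le> 2 * \<eta> * 2 + \<eta> * 1 * 4"
      unfolding power2_eq_square using \<eta> \<nu> \<tau> by (intro add_mono mult_mono mult_left_mono) auto
    finally have q: "\<bar>q\<bar> \<le> 8 * \<eta>" by simp
    then have q2: "\<bar>q\<bar> \<le> 1/2" using \<eta> by simp
    have "norm (z + \<eta> *\<^sub>R u) = sqrt (1 + q)"
      using N2 by (metis norm_ge_zero real_sqrt_unique)
    then have eq: "norm (z + \<eta> *\<^sub>R u) powr (- s) = (1 + q) powr (- (s/2))"
      using q2 by (simp add: powr_half_sqrt[symmetric] powr_powr)
    have E: "?E = 1 - s/2 * q + s/2 * (s/2 + 1) / 2 * (4 * \<eta>\<^sup>2 * \<tau>\<^sup>2)"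
      unfolding q_def \<tau>_def[symmetric] \<nu>_def[symmetric] by (simp add: field_simps power2_eq_square)
    have "q\<^sup>2 - 4 * \<eta>\<^sup>2 * \<tau>\<^sup>2 = \<eta> ^ 3 * (4 * \<tau> * \<nu> + \<eta> * \<nu>\<^sup>2)"
      by (simp add: q_def power2_eq_square power3_eq_cube algebra_simps)
    moreover have "\<bar>4 * \<tau> * \<nu> + \<eta> * \<nu>\<^sup>2\<bar> \<le> 48"
    proof -
      have "\<bar>4 * \<tau> * \<nu> + \<eta> * \<nu>\<^sup>2\<bar> \<le> 4 * (\<bar>\<tau>\<bar> * \<nu>) + \<eta> * \<nu>\<^sup>2"
        using \<eta> \<nu> by (intro order_trans[OF abs_triangle_ineq]) (simp add: abs_mult)
      also have "\<dots> \<le> 4 * (2 * 4) + 1 * 4\<^sup>2"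
        using \<eta> \<nu> \<tau> by (intro add_mono mult_mono mult_left_mono power_mono) auto
      finally show ?thesis by simp
    qed
    ultimately have "\<bar>q\<^sup>2 - 4 * \<eta>\<^sup>2 * \<tau>\<^sup>2\<bar> \<le> \<eta> ^ 3 * 48"
      using \<eta> by (simp add: abs_mult mult_left_mono)
    then have "\<bar>s/2 * (s/2 + 1) / 2 * q\<^sup>2 - s/2 * (s/2 + 1) / 2 * (4 * \<eta>\<^sup>2 * \<tau>\<^sup>2)\<bar>
        \<le> s/2 * (s/2 + 1) / 2 * 48 * \<eta> ^ 3"
      unfolding right_diff_distrib[symmetric] abs_mult mult.assoc
      using assms by (simp add: mult_left_mono mult.commute)
    moreover have "C * \<bar>q\<bar> ^ 3 \<le> C * (8 * \<eta>) ^ 3"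
      using C(1) q by (intro mult_left_mono power_mono) auto
    ultimately show ?thesis
      using C(2)[OF q2] unfolding eq E C'_def power_mult_distrib distrib_right by linarith
  qed
  moreover have "C' \<ge> 0" using C(1) assms by (simp add: C'_def)
  ultimately show ?thesis by blast
qed

text \<open>The points \<open>z + \<eta> \<delta> b\<^sub>i\<close> form a cluster much tighter than the step \<open>\<eta>\<close>. The first-order terms
  cancel exactly because each \<open>b\<^sub>i\<close> is kept in the displaced point, and the second-order ones
  add up to \<open>\<eta>\<^sup>2\<close> times the Laplacian \<open>s (s + 2 - p)\<close> of the kernel, up to \<open>O(\<delta>)\<close>.\<close>

lemma spread_gain:
  fixes s :: real
  assumes s: "s > 0" "s > real DIM('a::euclidean_space) - 2"
  obtains \<eta>\<^sub>0 \<delta> \<gamma> where "\<eta>\<^sub>0 > 0" "\<delta> > 0" "\<gamma> > 0" "\<eta>\<^sub>0 \<le> 1/16" "\<delta> \<le> 1"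
    and "\<And>\<eta> (z::'a) b. 0 < \<eta> \<Longrightarrow> \<eta> \<le> \<eta>\<^sub>0 \<Longrightarrow> norm z = 1 \<Longrightarrow>
      (\<And>i. i \<in> Basis \<times> {1, -1} \<Longrightarrow> norm (b i) \<le> 1) \<Longrightarrow>
      (\<Sum>i\<in>Basis \<times> {1, -1}. norm (z + \<eta> *\<^sub>R (\<delta> *\<^sub>R b i)) powr (- s)) + \<gamma> * \<eta>\<^sup>2
      \<le> (\<Sum>i\<in>Basis \<times> {1, -1}. norm (z + \<eta> *\<^sub>R (\<delta> *\<^sub>R b i + snd i *\<^sub>R fst i)) powr (- s))"
proof -
  define I :: "('a \<times> real) set" where "I = Basis \<times> {1, -1}"
  define n where "n = 2 * real DIM('a)"
  have n: "n > 0" by (simp add: n_def)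
  have cardI: "real (card I) = n" by (simp add: I_def n_def)
  define v :: "'a \<times> real \<Rightarrow> 'a" where "v i = snd i *\<^sub>R fst i" for i
  have nv: "norm (v i) = 1" if "i \<in> I" for i using that by (auto simp: I_def v_def)
  obtain C where C: "C \<ge> 0" "\<And>(z::'a) u \<eta>.
    norm z = 1 \<Longrightarrow> norm u \<le> 2 \<Longrightarrow> 0 \<le> \<eta> \<Longrightarrow> \<eta> \<le> 1/16 \<Longrightarrow>
    \<bar>norm (z + \<eta> *\<^sub>R u) powr (- s)
      - (1 - s * \<eta> * (z \<bullet> u) + \<eta>\<^sup>2 / 2 * (s * (s + 2) * (z \<bullet> u)\<^sup>2 - s * (u \<bullet> u)))\<bar> \<le> C * \<eta> ^ 3"
    using norm_powr_expansion[OF s(1)] by blast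
  \<comment> \<open>\<open>s * g\<close> is the Laplacian of the kernel at distance 1; the
    hypothesis on \<open>s\<close> says exactly that \<open>g\<close> is positive.\<close>
  define g where "g = s + 2 - real DIM('a)"
  have g: "g > 0" using s by (simp add: g_def)
  \<comment> \<open>\<open>\<delta>\<close> and \<open>\<eta>\<^sub>0\<close> are chosen so that the
    cluster error and the cubic remainder each consume at most a quarter of the gain
    \<open>s * g * \<eta>\<^sup>2\<close>, leaving half. \<open>C + 1\<close> avoids division by
    zero.\<close>
  define \<delta> where "\<delta> = min 1 (g / (4 * n * (s + 3)))"
  define \<eta>\<^sub>0 where "\<eta>\<^sub>0 = min (1/16) (s * g / (8 * n * (C + 1)))"
  have \<delta>: "\<delta> > 0" "\<delta> \<le> 1" using g n s by (auto simp: \<delta>_def)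
  have \<eta>\<^sub>0: "\<eta>\<^sub>0 > 0" "\<eta>\<^sub>0 \<le> 1/16"
    using g n s C(1) by (simp_all add: \<eta>\<^sub>0_def del: divide_le_eq_numeral1 le_divide_eq_numeral1)
  have "\<delta> \<le> g / (4 * n * (s + 3))" by (simp add: \<delta>_def)
  then have "\<delta> * (4 * n * (s + 3)) \<le> g"
    using n s by (subst (asm) pos_le_divide_eq) auto
  then have \<delta>2: "n * \<delta> * (s + 3) \<le> g / 4" by (simp add: mult_ac)
  have "\<eta>\<^sub>0 \<le> s * g / (8 * n * (C + 1))" by (simp add: \<eta>\<^sub>0_def)
  then have "8 * n * (C + 1) * \<eta>\<^sub>0 \<le> s * g"
    using n C(1) by (subst (asm) pos_le_divide_eq) (auto simp: mult_ac)
  then have \<eta>\<^sub>02: "8 * n * C * \<eta>\<^sub>0 \<le> s * g"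
    using mult_pos_pos[OF n \<eta>\<^sub>0(1)] by (simp add: algebra_simps)
  have gain: "(\<Sum>i\<in>I. norm (z + \<eta> *\<^sub>R (\<delta> *\<^sub>R b i)) powr (- s)) + s * g / 2 * \<eta>\<^sup>2
      \<le> (\<Sum>i\<in>I. norm (z + \<eta> *\<^sub>R (\<delta> *\<^sub>R b i + v i)) powr (- s))"
    if \<eta>: "0 < \<eta>" "\<eta> \<le> \<eta>\<^sub>0" and z: "norm z = 1" and b: "\<And>i. i \<in> I \<Longrightarrow> norm (b i) \<le> 1" for \<eta> z b
  proof -
    have zz: "z \<bullet> z = 1" using z by (simp add: norm_eq_1)
    \<comment> \<open>Difference of the expansions at
      \<open>u = \<delta> *\<^sub>R b i + v i\<close> and \<open>u = \<delta> *\<^sub>R b i\<close>.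
      The mixed terms carry a factor \<open>\<delta>\<close> and are bounded by Cauchy-Schwarz; two
      remainders give \<open>2 * C * \<eta> ^ 3\<close>.\<close>
    have term_le: "norm (z + \<eta> *\<^sub>R (\<delta> *\<^sub>R b i)) powr (- s)
        + (- s * \<eta> * (z \<bullet> v i) + \<eta>\<^sup>2 / 2 * (s * (s + 2) * (z \<bullet> v i)\<^sup>2 - s)
            - \<eta>\<^sup>2 * \<delta> * (s * (s + 3)) - 2 * C * \<eta> ^ 3)
        \<le> norm (z + \<eta> *\<^sub>R (\<delta> *\<^sub>R b i + v i)) powr (- s)" if i: "i \<in> I" for i
    proof -
      define \<beta> where "\<beta> = z \<bullet> b i"
      define \<tau> where "\<tau> = z \<bullet> v i"
      define \<mu> where "\<mu> = b i \<bullet> v i"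
      have vv: "v i \<bullet> v i = 1" using nv[OF i] by (simp add: norm_eq_1)
      have \<beta>: "\<bar>\<beta>\<bar> \<le> 1"
        using Cauchy_Schwarz_ineq2[of z "b i"] z b[OF i] by (simp add: \<beta>_def)
      have \<tau>: "\<bar>\<tau>\<bar> \<le> 1"
        using Cauchy_Schwarz_ineq2[of z "v i"] z nv[OF i] by (simp add: \<tau>_def)
      have \<mu>: "\<bar>\<mu>\<bar> \<le> 1"
        using Cauchy_Schwarz_ineq2[of "b i" "v i"] b[OF i] nv[OF i] by (simp add: \<mu>_def)
      have db: "norm (\<delta> *\<^sub>R b i) \<le> 1" using \<delta> b[OF i] by (simp add: mult_le_one)
      have dbv: "norm (\<delta> *\<^sub>R b i + v i) \<le> 2"
        using norm_triangle_ineq[of "\<delta> *\<^sub>R b i" "v i"] db nv[OF i] by simp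
      have "\<bar>\<beta> * \<tau>\<bar> \<le> 1" using \<beta> \<tau> by (simp add: abs_mult mult_le_one)
      then have "s * (s + 2) * (\<beta> * \<tau>) \<ge> s * (s + 2) * (-1)"
        using s by (intro mult_left_mono) auto
      moreover have "s * \<mu> \<le> s * 1" using \<mu> s by (intro mult_left_mono) auto
      ultimately have "- (s * (s + 3)) \<le> s * (s + 2) * (\<beta> * \<tau>) - s * \<mu>"
        by (simp add: algebra_simps)
      then have "\<eta>\<^sup>2 * \<delta> * (- (s * (s + 3))) \<le> \<eta>\<^sup>2 * \<delta> * (s * (s + 2) * (\<beta> * \<tau>) - s * \<mu>)"
        using \<delta> by (intro mult_left_mono) auto
      moreover
      have "1 - s * \<eta> * (z \<bullet> (\<delta> *\<^sub>R b i + v i)) + \<eta>\<^sup>2 / 2 * (s * (s + 2) * (z \<bullet> (\<delta> *\<^sub>R b i + v i))\<^sup>2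
            - s * ((\<delta> *\<^sub>R b i + v i) \<bullet> (\<delta> *\<^sub>R b i + v i)))
          = 1 - s * \<eta> * (z \<bullet> (\<delta> *\<^sub>R b i)) + \<eta>\<^sup>2 / 2 * (s * (s + 2) * (z \<bullet> (\<delta> *\<^sub>R b i))\<^sup>2
            - s * ((\<delta> *\<^sub>R b i) \<bullet> (\<delta> *\<^sub>R b i)))
          + (- s * \<eta> * \<tau> + \<eta>\<^sup>2 / 2 * (s * (s + 2) * \<tau>\<^sup>2 - s)
            + \<eta>\<^sup>2 * \<delta> * (s * (s + 2) * (\<beta> * \<tau>) - s * \<mu>))"
        unfolding inner_add_left inner_add_right inner_scaleR_left inner_scaleR_right vv
          inner_commute[of "v i" "b i"] \<beta>_def[symmetric] \<tau>_def[symmetric] \<mu>_def[symmetric]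
        by (simp add: field_simps power2_eq_square)
      moreover note C(2)[OF z dbv, of \<eta>] C(2)[OF z, of "\<delta> *\<^sub>R b i" \<eta>]
      ultimately show ?thesis
        using \<eta> \<eta>\<^sub>0 db unfolding \<tau>_def[symmetric] by (simp add: abs_le_iff)
    qed
    have S1: "(\<Sum>i\<in>I. z \<bullet> v i) = 0"
    proof -
      have "(\<Sum>i\<in>I. z \<bullet> v i) = (\<Sum>e\<in>Basis. \<Sum>t\<in>{1,-1::real}. t * (z \<bullet> e))"
        unfolding I_def v_def sum.cartesian_product by (simp add: case_prod_unfold)
      then show ?thesis by simp
    qed
    \<comment> \<open>Parseval for the unit vector \<open>z\<close>, each axis being counted with
      both signs.\<close>
    have S2: "(\<Sum>i\<in>I. (z \<bullet> v i)\<^sup>2) = 2"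
    proof -
      have "(\<Sum>i\<in>I. (z \<bullet> v i)\<^sup>2) = (\<Sum>e\<in>Basis. \<Sum>t\<in>{1,-1::real}. (t * (z \<bullet> e))\<^sup>2)"
        unfolding I_def v_def sum.cartesian_product by (simp add: case_prod_unfold)
      also have "\<dots> = 2 * (\<Sum>e\<in>Basis. (z \<bullet> e)\<^sup>2)" by (simp add: sum_distrib_left)
      also have "(\<Sum>e\<in>Basis. (z \<bullet> e)\<^sup>2) = 1"
        using euclidean_inner[of z z] zz by (simp add: power2_eq_square)
      finally show ?thesis by simp
    qed
    have "(\<Sum>i\<in>I. - s * \<eta> * (z \<bullet> v i) + \<eta>\<^sup>2 / 2 * (s * (s + 2) * (z \<bullet> v i)\<^sup>2 - s)
            - \<eta>\<^sup>2 * \<delta> * (s * (s + 3)) - 2 * C * \<eta> ^ 3)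
        = - s * \<eta> * (\<Sum>i\<in>I. z \<bullet> v i) + \<eta>\<^sup>2 / 2 * (s * (s + 2) * (\<Sum>i\<in>I. (z \<bullet> v i)\<^sup>2) - n * s)
            - n * (\<eta>\<^sup>2 * \<delta> * (s * (s + 3))) - n * (2 * C * \<eta> ^ 3)"
      by (simp only: sum.distrib sum_subtractf sum_distrib_left[symmetric] sum_constant cardI)
        (simp add: algebra_simps)
    also have "\<dots> = \<eta>\<^sup>2 * (s * g - n * \<delta> * (s + 3) * s - 2 * n * C * \<eta>)"
      unfolding S1 S2 by (simp add: g_def n_def algebra_simps power2_eq_square power3_eq_cube)
    also have "\<dots> \<ge> \<eta>\<^sup>2 * (s * g - g / 4 * s - s * g / 4)"
    proof (intro mult_left_mono diff_mono)
      show "n * \<delta> * (s + 3) * s \<le> g / 4 * s" using \<delta>2 s by (intro mult_right_mono) auto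
      have "8 * n * C * \<eta> \<le> 8 * n * C * \<eta>\<^sub>0" using \<eta> n C by (intro mult_left_mono) auto
      then show "2 * n * C * \<eta> \<le> s * g / 4" using \<eta>\<^sub>02 by simp
    qed (use s in auto)
    finally have "s * g / 2 * \<eta>\<^sup>2
      \<le> (\<Sum>i\<in>I. - s * \<eta> * (z \<bullet> v i) + \<eta>\<^sup>2 / 2 * (s * (s + 2) * (z \<bullet> v i)\<^sup>2 - s)
            - \<eta>\<^sup>2 * \<delta> * (s * (s + 3)) - 2 * C * \<eta> ^ 3)"
      by (simp add: algebra_simps)
    moreover have "(\<Sum>i\<in>I. norm (z + \<eta> *\<^sub>R (\<delta> *\<^sub>R b i)) powr (- s)) + \<dots>
        \<le> (\<Sum>i\<in>I. norm (z + \<eta> *\<^sub>R (\<delta> *\<^sub>R b i + v i)) powr (- s))"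
      unfolding sum.distrib[symmetric] by (rule sum_mono) (rule term_le)
    ultimately show ?thesis by linarith
  qed
  have "s * g / 2 > 0" using s g by simp
  then show thesis
    by (rule that[OF \<eta>\<^sub>0(1) \<delta>(1) _ \<eta>\<^sub>0(2) \<delta>(2) gain[unfolded I_def v_def]])
qed

text \<open>If a ball of radius \<open>\<rho> \<epsilon>\<close> held \<open>2 p\<close> points, a step \<open>h = \<eta>\<^sub>0 \<epsilon>\<close> in the directions
  \<open>\<plusminus>e\<^sub>k\<close> would help. Seen from \<open>a \<in> A\<close> at distance \<open>D \<ge> \<epsilon>\<close>, rescaling by \<open>1/D\<close> turns this step into
  the one of \<open>spread_gain\<close> with \<open>\<eta> = h / D \<le> \<eta>\<^sub>0\<close>.\<close>

lemma optimal_cluster_size: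
  fixes s :: real
  assumes s: "s > 0" "s > real DIM('a::euclidean_space) - 2"
  shows "\<exists>\<rho>>0. \<forall>(A::'a set) \<epsilon> \<omega> x. A \<noteq> {} \<longrightarrow> compact A \<longrightarrow> \<epsilon> > 0 \<longrightarrow>
    polarization s A \<omega> = max_polarization s A (size \<omega>) \<longrightarrow>
    max_polarization s A (size \<omega>) < \<infinity> \<longrightarrow> infdist x A \<ge> \<epsilon> \<longrightarrow>
    size {#y \<in># \<omega>. dist x y \<le> \<rho> * \<epsilon>#} < 2 * DIM('a)"
proof -
  define I :: "('a \<times> real) set" where "I = Basis \<times> {1, -1}"
  have finI: "finite I" by (simp add: I_def)
  have cardI: "card I = 2 * DIM('a)" by (simp add: I_def)
  define v :: "'a \<times> real \<Rightarrow> 'a" where "v i = snd i *\<^sub>R fst i" for i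
  obtain \<eta>\<^sub>0 \<delta> \<gamma> where pos: "\<eta>\<^sub>0 > 0" "\<delta> > 0" "\<gamma> > 0" "\<eta>\<^sub>0 \<le> 1/16" "\<delta> \<le> 1"
    and spread: "\<And>\<eta> (z::'a) b. 0 < \<eta> \<Longrightarrow> \<eta> \<le> \<eta>\<^sub>0 \<Longrightarrow> norm z = 1 \<Longrightarrow> (\<And>i. i \<in> I \<Longrightarrow> norm (b i) \<le> 1) \<Longrightarrow>
      (\<Sum>i\<in>I. norm (z + \<eta> *\<^sub>R (\<delta> *\<^sub>R b i)) powr (- s)) + \<gamma> * \<eta>\<^sup>2
      \<le> (\<Sum>i\<in>I. norm (z + \<eta> *\<^sub>R (\<delta> *\<^sub>R b i + v i)) powr (- s))"
    unfolding I_def v_def by (fact spread_gain[OF s])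
  \<comment> \<open>With this radius the offset of a cluster point from \<open>x\<close>, divided by
    \<open>D\<close>, becomes \<open>\<eta> * \<delta>\<close> times a vector \<open>b i\<close> of
    norm at most 1.\<close>
  define \<rho> where "\<rho> = \<delta> * \<eta>\<^sub>0"
  have \<rho>: "\<rho> > 0" "\<rho> < 1" using pos mult_mono[of \<delta> 1 \<eta>\<^sub>0 "1/16"] by (auto simp: \<rho>_def)
  have "size {#y \<in># \<omega>. dist x y \<le> \<rho> * \<epsilon>#} < 2 * DIM('a)"
    if A: "A \<noteq> {}" "compact A" and \<epsilon>: "\<epsilon> > 0"
      and opt: "polarization s A \<omega> = max_polarization s A (size \<omega>)"
      and fin: "max_polarization s A (size \<omega>) < \<infinity>"
      and x: "infdist x A \<ge> \<epsilon>"
    for A :: "'a set" and \<epsilon> \<omega> x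
  proof (rule ccontr)
    assume "\<not> ?thesis"
    then have le: "card I \<le> size {#y \<in># \<omega>. dist x y \<le> \<rho> * \<epsilon>#}" by (simp add: cardI)
    obtain zs where zs: "mset zs = {#y \<in># \<omega>. dist x y \<le> \<rho> * \<epsilon>#}" using ex_mset by blast
    \<comment> \<open>Exactly one cluster entry is assigned to each of the \<open>2 p\<close>
      directions. Passing through a list keeps repeated points apart.\<close>
    define xs where "xs = take (card I) zs"
    define M where "M = mset xs"
    have M: "M \<subseteq># {#y \<in># \<omega>. dist x y \<le> \<rho> * \<epsilon>#}"
      unfolding zs[symmetric] M_def xs_def
      by (metis append_take_drop_id mset_append mset_subset_eq_add_left)
    have len: "length xs = card I" using le unfolding zs[symmetric] by (simp add: xs_def)
    obtain g where g: "bij_betw g I {..<length xs}"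
      using ex_bij_betw_finite_nat[OF finI] unfolding len atLeast0LessThan by blast
    define y where "y i = xs ! g i" for i
    have My: "M = image_mset y (mset_set I)"
    proof -
      have "image_mset g (mset_set I) = mset_set {..<length xs}"
        using g by (simp add: bij_betw_def image_mset_mset_set)
      moreover have "M = image_mset ((!) xs) (mset_set {..<length xs})"
        unfolding M_def by (metis map_nth mset_map mset_upt lessThan_atLeast0)
      ultimately show ?thesis
        by (metis y_def image_mset.compositionality image_mset_cong comp_def)
    qed
    have near: "dist x (y i) \<le> \<rho> * \<epsilon>" if "i \<in> I" for i
    proof -
      have "y i \<in># M" using that finI by (simp add: My)
      then show ?thesis using M by (auto dest!: mset_subset_eqD)
    qed
    define M' where "M' = image_mset (\<lambda>i. y i + (\<eta>\<^sub>0 * \<epsilon>) *\<^sub>R v i) (mset_set I)"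
    have far: "dist x a \<ge> \<epsilon>" if "a \<in> A" for a
      using infdist_le[OF that, of x] x by simp
    obtain B where B: "\<And>a. a \<in> A \<Longrightarrow> dist x a \<le> B"
      using compact_imp_bounded[OF A(2)] bounded_any_center[of A x] by auto
    have Bpos: "B > 0" using A(1) far B \<epsilon> by (metis all_not_in_conv order_less_le_trans)
    show False
    proof (rule optimal_no_gain[OF opt fin, of M M'])
      show "M \<subseteq># \<omega>" using M multiset_filter_subset by (rule subset_mset.order_trans)
      show "size M' = size M" by (simp add: M'_def My)
      \<comment> \<open>The gain at distance \<open>D\<close> is proportional to
        \<open>D powr (- s)\<close> over \<open>D\<^sup>2\<close>, hence smallest at
        \<open>D = B\<close>.\<close>
      show "B powr (- s) * (\<gamma> * (\<eta>\<^sub>0 * \<epsilon> / B)\<^sup>2) > 0" using pos Bpos \<epsilon> by simp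
      fix a assume a: "a \<in> A"
      define D where "D = norm (x - a)"
      have D: "\<epsilon> \<le> D" "D \<le> B" "D > 0" using far[OF a] B[OF a] \<epsilon> by (auto simp: D_def dist_norm)
      define \<eta> where "\<eta> = \<eta>\<^sub>0 * \<epsilon> / D"
      define z where "z = (x - a) /\<^sub>R D"
      define b where "b i = (y i - x) /\<^sub>R (\<rho> * \<epsilon>)" for i
      have \<eta>: "0 < \<eta>" "\<eta> \<le> \<eta>\<^sub>0" using pos D \<epsilon> by (auto simp: \<eta>_def field_simps)
      have z: "norm z = 1" using D by (simp add: z_def D_def)
      have nb: "norm (b i) \<le> 1" if "i \<in> I" for i
        using near[OF that] \<rho> \<epsilon> by (simp add: b_def dist_norm norm_minus_commute divide_simps)
      have ya: "y i - a = D *\<^sub>R (z + \<eta> *\<^sub>R (\<delta> *\<^sub>R b i))" for i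
      proof -
        have "D *\<^sub>R (z + \<eta> *\<^sub>R (\<delta> *\<^sub>R b i)) = (x - a) + (D * \<eta> * \<delta> / (\<rho> * \<epsilon>)) *\<^sub>R (y i - x)"
          using D by (simp add: z_def b_def scaleR_add_right divide_inverse mult_ac)
        also have "D * \<eta> * \<delta> / (\<rho> * \<epsilon>) = 1" using D pos \<epsilon> by (simp add: \<eta>_def \<rho>_def)
        finally show ?thesis by simp
      qed
      have y'a: "y i + (\<eta>\<^sub>0 * \<epsilon>) *\<^sub>R v i - a = D *\<^sub>R (z + \<eta> *\<^sub>R (\<delta> *\<^sub>R b i + v i))" for i
      proof -
        have "D *\<^sub>R (z + \<eta> *\<^sub>R (\<delta> *\<^sub>R b i + v i)) = (y i - a) + (D * \<eta>) *\<^sub>R v i"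
          unfolding ya by (simp add: algebra_simps)
        also have "D * \<eta> = \<eta>\<^sub>0 * \<epsilon>" using D by (simp add: \<eta>_def)
        finally show ?thesis by simp
      qed
      \<comment> \<open>Cluster points stay off \<open>A\<close>, so the old kernel values are
        finite and the comparison can be made in the reals.\<close>
      have ne: "y i \<noteq> a" if "i \<in> I" for i
      proof -
        have "\<rho> * \<epsilon> < \<epsilon>" using \<rho> \<epsilon> by simp
        then show ?thesis using near[OF that] far[OF a] by auto
      qed
      have "B powr (- s) * (\<gamma> * (\<eta>\<^sub>0 * \<epsilon> / B)\<^sup>2) \<le> D powr (- s) * (\<gamma> * \<eta>\<^sup>2)"
        unfolding \<eta>_def using D pos \<epsilon> s Bpos
        by (intro mult_mono powr_mono2' power_mono divide_left_mono) auto
      then have "(\<Sum>i\<in>I. norm (y i - a) powr (- s)) + B powr (- s) * (\<gamma> * (\<eta>\<^sub>0 * \<epsilon> / B)\<^sup>2)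
          \<le> D powr (- s) * ((\<Sum>i\<in>I. norm (z + \<eta> *\<^sub>R (\<delta> *\<^sub>R b i)) powr (- s)) + \<gamma> * \<eta>\<^sup>2)"
        unfolding ya norm_scaleR using D
        by (simp add: powr_mult distrib_left sum_distrib_left)
      also have "\<dots> \<le> D powr (- s) * (\<Sum>i\<in>I. norm (z + \<eta> *\<^sub>R (\<delta> *\<^sub>R b i + v i)) powr (- s))"
        using spread[OF \<eta> z nb] by (intro mult_left_mono) auto
      also have "\<dots> = (\<Sum>i\<in>I. norm (y i + (\<eta>\<^sub>0 * \<epsilon>) *\<^sub>R v i - a) powr (- s))"
        unfolding y'a norm_scaleR using D by (simp add: powr_mult sum_distrib_left)
      finally have real_le: "(\<Sum>i\<in>I. norm (y i - a) powr (- s)) + B powr (- s) * (\<gamma> * (\<eta>\<^sub>0 * \<epsilon> / B)\<^sup>2)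
          \<le> (\<Sum>i\<in>I. norm (y i + (\<eta>\<^sub>0 * \<epsilon>) *\<^sub>R v i - a) powr (- s))" .
      have "(\<Sum>x\<in>#M. riesz_kernel s x a) = (\<Sum>i\<in>I. riesz_kernel s (y i) a)"
        by (simp add: My sum_unfold_sum_mset image_mset.compositionality comp_def)
      also have "\<dots> = ennreal (\<Sum>i\<in>I. norm (y i - a) powr (- s))"
        using ne by (simp add: riesz_kernel_def sum_ennreal cong: sum.cong)
      finally have "(\<Sum>x\<in>#M. riesz_kernel s x a) + ennreal (B powr (- s) * (\<gamma> * (\<eta>\<^sub>0 * \<epsilon> / B)\<^sup>2))
          \<le> ennreal (\<Sum>i\<in>I. norm (y i + (\<eta>\<^sub>0 * \<epsilon>) *\<^sub>R v i - a) powr (- s))"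
        using real_le pos
        by (simp add: ennreal_plus[symmetric] sum_nonneg ennreal_leI del: ennreal_plus)
      also have "\<dots> = (\<Sum>i\<in>I. ennreal (norm (y i + (\<eta>\<^sub>0 * \<epsilon>) *\<^sub>R v i - a) powr (- s)))"
        by (simp add: sum_ennreal)
      \<comment> \<open>An inequality suffices here: if a displaced point were equal to
        \<open>a\<close>, its kernel value would be infinite.\<close>
      also have "\<dots> \<le> (\<Sum>i\<in>I. riesz_kernel s (y i + (\<eta>\<^sub>0 * \<epsilon>) *\<^sub>R v i) a)"
        by (intro sum_mono) (simp add: riesz_kernel_def)
      also have "\<dots> = (\<Sum>x\<in>#M'. riesz_kernel s x a)"
        by (simp add: M'_def sum_unfold_sum_mset image_mset.compositionality comp_def)
      finally show "(\<Sum>x\<in>#M. riesz_kernel s x a) + ennreal (B powr (- s) * (\<gamma> * (\<eta>\<^sub>0 * \<epsilon> / B)\<^sup>2))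
          \<le> (\<Sum>x\<in>#M'. riesz_kernel s x a)" .
    qed
  qed
  then show ?thesis using \<rho>(1) by blast
qed

section \<open>Volume packing\<close>

text \<open>The balls of radius \<open>r\<close> around the points of \<open>T\<close> are disjoint,
  so their volumes add up inside \<open>U\<close>.\<close>

lemma card_separated_le_volume:
  fixes T U :: "'a::euclidean_space set"
  assumes "finite T" "pairwise (\<lambda>x y. dist x y > 2 * r) T" "r > 0"
    and "\<And>x. x \<in> T \<Longrightarrow> ball x r \<subseteq> U" and "U \<in> lmeasurable"
  shows "real (card T) * (unit_ball_vol DIM('a) * r ^ DIM('a)) \<le> measure lebesgue U"
proof -
  have "real (card T) * (unit_ball_vol DIM('a) * r ^ DIM('a)) = (\<Sum>x\<in>T. measure lebesgue (ball x r))"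
    using assms(3) by (simp add: content_ball)
  also have "\<dots> = measure lebesgue (\<Union>x\<in>T. ball x r)"
  proof (rule measure_UNION'[symmetric])
    show "pairwise (\<lambda>x y. disjnt (ball x r) (ball y r)) T"
      using assms(2) by (rule pairwise_mono) (auto intro!: disjoint_ballI simp: disjnt_def)
  qed (use assms(1) in auto)
  also have "\<dots> \<le> measure lebesgue U"
    using assms by (intro measure_mono_fmeasurable) auto
  finally show ?thesis .
qed

lemma open_nbhd_lmeasurable:
  fixes S :: "'a::euclidean_space set"
  assumes "bounded S" "S \<noteq> {}"
  shows "open_nbhd S r \<in> lmeasurable"
proof (rule lmeasurable_open)
  show "open (open_nbhd S r)"
    unfolding open_nbhd_def by (intro open_Collect_less continuous_intros)
  obtain x B where B: "S \<subseteq> cball x B" using assms(1) bounded_subset_cball by blast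
  show "bounded (open_nbhd S r)"
  proof (rule bounded_subset[OF bounded_cball])
    show "open_nbhd S r \<subseteq> cball x (B + r)"
    proof
      fix y assume "y \<in> open_nbhd S r"
      then obtain a where a: "a \<in> S" "dist y a < r"
        using infdist_notempty[OF assms(2), of y] cInf_lessD[of "dist y ` S" r] assms(2)
        by (auto simp: open_nbhd_def)
      then show "y \<in> cball x (B + r)"
        using B dist_triangle[of x y a] by (force simp: dist_commute)
    qed
  qed
qed

section \<open>The bound on the number of points far from \<open>A\<close>\<close>

theorem theorem1p8:
  fixes s :: real
  assumes "CARD('n::finite) \<ge> 2"
    and "s > real CARD('n) - 2"
  shows "\<exists>\<kappa> c :: real. \<kappa> > 0 \<and> c > 0 \<and>
    (\<forall>A :: (real ^ 'n) set. A \<noteq> {} \<longrightarrow> compact A \<longrightarrow>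
      (\<forall>(\<epsilon>::real) > 0. \<forall>(N::nat) (\<omega> :: (real ^ 'n) multiset).
        max_polarization s A N < \<infinity> \<longrightarrow>
        size \<omega> = N \<longrightarrow>
        polarization s A \<omega> = max_polarization s A N \<longrightarrow>
        real (size {#x \<in># \<omega>. x \<notin> open_nbhd A \<epsilon>#})
          \<le> \<kappa> * measure lebesgue (open_nbhd (convex hull A) (\<epsilon> * c)) / \<epsilon> ^ CARD('n)))"
proof -
  have s: "s > 0" "s > real DIM(real ^ 'n) - 2" using assms by auto
  define k where "k = 2 * CARD('n)"
  obtain \<rho> where \<rho>: "\<rho> > 0" and cluster: "\<And>(A::(real^'n) set) \<epsilon> \<omega> x. A \<noteq> {} \<Longrightarrow> compact A \<Longrightarrow> \<epsilon> > 0 \<Longrightarrow>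
    polarization s A \<omega> = max_polarization s A (size \<omega>) \<Longrightarrow>
    max_polarization s A (size \<omega>) < \<infinity> \<Longrightarrow> infdist x A \<ge> \<epsilon> \<Longrightarrow>
    size {#y \<in># \<omega>. dist x y \<le> \<rho> * \<epsilon>#} < k"
    using optimal_cluster_size[OF s] unfolding k_def by auto
  \<comment> \<open>\<open>V * \<epsilon> ^ CARD('n)\<close> is the volume of one packing ball, of
    radius \<open>\<epsilon> * (\<rho> / 2)\<close>. As \<open>\<rho>\<close> is fixed before
    \<open>A\<close>, the constants \<open>k / V\<close> and \<open>\<rho> / 2\<close> depend on
    \<open>s\<close> and the dimension only.\<close>
  define V where "V = unit_ball_vol (real CARD('n)) * (\<rho> / 2) ^ CARD('n)"
  have V: "V > 0" using \<rho> by (simp add: V_def)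
  have main: "real (size {#x \<in># \<omega>. x \<notin> open_nbhd A \<epsilon>#})
      \<le> real k / V * measure lebesgue (open_nbhd (convex hull A) (\<epsilon> * (\<rho> / 2))) / \<epsilon> ^ CARD('n)"
    if A: "A \<noteq> {}" "compact A" and \<epsilon>: "\<epsilon> > 0"
      and fin: "max_polarization s A (size \<omega>) < \<infinity>"
      and opt: "polarization s A \<omega> = max_polarization s A (size \<omega>)"
    for A :: "(real ^ 'n) set" and \<epsilon> \<omega>
  proof -
    define X where "X = {#x \<in># \<omega>. x \<notin> open_nbhd A \<epsilon>#}"
    let ?U = "open_nbhd (convex hull A) (\<epsilon> * (\<rho> / 2))"
    have "size {#y \<in># X. dist x y \<le> \<rho> * \<epsilon>#} \<le> k" if "x \<in># X" for x
    proof -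
      have "size {#y \<in># X. dist x y \<le> \<rho> * \<epsilon>#} \<le> size {#y \<in># \<omega>. dist x y \<le> \<rho> * \<epsilon>#}"
        by (intro size_mset_mono multiset_filter_mono) (simp add: X_def)
      also have "\<dots> < k"
        using that by (intro cluster[OF A \<epsilon> opt fin]) (simp add: X_def open_nbhd_def)
      finally show ?thesis by simp
    qed
    then obtain T where T: "T \<subseteq> set_mset X" "pairwise (\<lambda>x y. dist x y > \<rho> * \<epsilon>) T"
      "size X \<le> k * card T"
      using sparse_mset_separated_subset[of "\<rho> * \<epsilon>" X k] \<rho> \<epsilon> by auto
    have "real (card T) * (unit_ball_vol DIM(real ^ 'n) * (\<epsilon> * (\<rho> / 2)) ^ DIM(real ^ 'n))
        \<le> measure lebesgue ?U"
    proof (rule card_separated_le_volume)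
      show "finite T" using T(1) by (rule finite_subset) simp
      show "pairwise (\<lambda>x y. dist x y > 2 * (\<epsilon> * (\<rho> / 2))) T" using T(2) by (simp add: mult.commute)
      show "\<epsilon> * (\<rho> / 2) > 0" using \<rho> \<epsilon> by simp
      show "?U \<in> lmeasurable"
        using A by (intro open_nbhd_lmeasurable bounded_convex_hull compact_imp_bounded) auto
      fix x assume "x \<in> T"
      \<comment> \<open>The centres lie in the convex hull of \<open>A\<close>, so the packing balls
        stay in its neighbourhood.\<close>
      then have "x \<in> convex hull A"
        using T(1) by (intro optimal_in_convex_hull[OF s(1) A opt fin]) (auto simp: X_def)
      then show "ball x (\<epsilon> * (\<rho> / 2)) \<subseteq> ?U"
        unfolding open_nbhd_def by (auto simp only: mem_ball mem_Collect_eq dist_commute[of x]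
            intro: order_le_less_trans[OF infdist_le])
    qed
    then have "real (card T) * V * \<epsilon> ^ CARD('n) \<le> measure lebesgue ?U"
      by (simp add: V_def power_mult_distrib power_divide mult_ac)
    then have "real (card T) \<le> measure lebesgue ?U / V / \<epsilon> ^ CARD('n)"
      using V \<epsilon> by (simp add: field_simps)
    then have "real k * real (card T) \<le> real k * (measure lebesgue ?U / V / \<epsilon> ^ CARD('n))"
      by (rule mult_left_mono) simp
    moreover have "real (size X) \<le> real k * real (card T)"
      using T(3) by (metis of_nat_le_iff of_nat_mult)
    ultimately show ?thesis unfolding X_def by simp
  qed
  show ?thesis
  proof (intro exI conjI allI impI)
    show "real k / V > 0" "\<rho> / 2 > 0" using V \<rho> by (auto simp: k_def)
  qed (use main in blast)
qed
end
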